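(* Let $n\geqslant 2$, let $H$ be a complex Hilbert space, let $H_1,\dots,H_n$ be closed subspaces of $H$, and let $P_i$ be the orthogonal projection of $H$ onto $H_i$, $i=1,\dots,n$. Then $$\|P_1+\dots+P_n\|=1+(n-1)\,c_D(H_1,\dots,H_n).$$
   Context: The Dixmier number of closed subspaces $H_1,\dots,H_n$ of $H$ is $$c_D(H_1,\dots,H_n):=\sup\left\{\frac{2}{n-1}\frac{\sum_{i<j}\mathrm{Re}\langle x_i,x_j\rangle}{\|x_1\|^2+\dots+\|x_n\|^2}\,:\, x_i\in H_i,\ i=1,\dots,n,\ (x_1,\dots,x_n)\neq(0,\dots,0)\right\}.$$ *)

theory Defs
  imports "HOL-Analysis.Analysis"
begin

text \<open>
  The library has no complex inner product spaces. As in \<open>real_inner\<close>, the norm (hence the metric and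
  the topology) is the one induced by the inner product, and the real scalar multiplication is the
  restriction of the complex one. The inner product is linear in its first argument.
\<close>

class complex_inner = real_normed_vector +
  fixes scaleC :: "complex \<Rightarrow> 'a \<Rightarrow> 'a"
    and cinner :: "'a \<Rightarrow> 'a \<Rightarrow> complex"
  assumes scaleC_add_right: "scaleC a (x + y) = scaleC a x + scaleC a y"
    and scaleC_add_left: "scaleC (a + b) x = scaleC a x + scaleC b x"
    and scaleC_scaleC: "scaleC a (scaleC b x) = scaleC (a * b) x"
    and scaleC_one: "scaleC 1 x = x"
    and scaleR_eq_scaleC: "scaleR r x = scaleC (complex_of_real r) x"
    and cinner_commute: "cinner x y = cnj (cinner y x)"
    and cinner_add_left: "cinner (x + y) z = cinner x z + cinner y z"
    and cinner_scaleC_left: "cinner (scaleC a x) y = a * cinner x y"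
    and cinner_self_nonneg: "0 \<le> Re (cinner x x)"
    and cinner_self_eq_0_iff: "cinner x x = 0 \<longleftrightarrow> x = 0"
    and norm_eq_sqrt_cinner: "norm x = sqrt (Re (cinner x x))"

class complex_hilbert_space = complex_inner + complete_space

instantiation complex :: complex_hilbert_space
begin

definition scaleC_complex :: "complex \<Rightarrow> complex \<Rightarrow> complex" where
  "scaleC_complex a x = a * x"

definition cinner_complex :: "complex \<Rightarrow> complex \<Rightarrow> complex" where
  "cinner_complex x y = x * cnj y"

instance
  by standard
    (auto simp: scaleC_complex_def cinner_complex_def algebra_simps scaleR_conv_of_real
      cmod_def power2_eq_square)

end

definition closed_complex_subspace :: "'a::complex_inner set \<Rightarrow> bool" where
  "closed_complex_subspace M \<longleftrightarrow>
     0 \<in> M \<and> (\<forall>x\<in>M. \<forall>y\<in>M. x + y \<in> M) \<and> (\<forall>a. \<forall>x\<in>M. scaleC a x \<in> M) \<and> closed M"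

text \<open>By the projection theorem, the point below exists uniquely when \<open>M\<close> is a closed subspace of a
  Hilbert space; for other \<open>M\<close> the value is irrelevant.\<close>

definition orth_proj :: "'a::complex_inner set \<Rightarrow> 'a \<Rightarrow> 'a" where
  "orth_proj M x = (THE y. y \<in> M \<and> (\<forall>z\<in>M. cinner (x - y) z = 0))"

text \<open>The supremum is one of real numbers, so it is meaningful only if the set is nonempty, that is, if
  some \<open>H i\<close> with \<open>1 \<le> i \<le> n\<close> is nonzero. Only the values of \<open>H\<close> and \<open>x\<close> on \<open>{1..n}\<close> matter.\<close>

definition dixmier_number :: "nat \<Rightarrow> (nat \<Rightarrow> 'a::complex_inner set) \<Rightarrow> real" where
  "dixmier_number n H =
     Sup {2 / (real n - 1) *
            ((\<Sum>j=1..n. \<Sum>i=1..<j. Re (cinner (x i) (x j))) / (\<Sum>i=1..n. (norm (x i))\<^sup>2)) | x.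
          (\<forall>i\<in>{1..n}. x i \<in> H i) \<and> (\<exists>i\<in>{1..n}. x i \<noteq> 0)}"

end

theory Submission imports Defs begin

text \<open>
  Let \<open>A\<close> be the map \<open>(x\<^sub>1, \<dots>, x\<^sub>n) \<mapsto> x\<^sub>1 + \<dots> + x\<^sub>n\<close> from the Hilbert direct sum of the \<open>H i\<close> to the
  whole space. Its adjoint is \<open>v \<mapsto> (P\<^sub>1 v, \<dots>, P\<^sub>n v)\<close>, so \<open>A A\<^sup>* = P\<^sub>1 + \<dots> + P\<^sub>n\<close> and the left-hand
  side of the theorem is \<open>\<parallel>A A\<^sup>*\<parallel> = \<parallel>A\<parallel>\<^sup>2\<close>. On the other hand, expanding the square gives
  \<open>\<parallel>x\<^sub>1 + \<dots> + x\<^sub>n\<parallel>\<^sup>2 = (\<Sum>i. \<parallel>x\<^sub>i\<parallel>\<^sup>2) + 2 (\<Sum>i<j. Re \<langle>x\<^sub>i, x\<^sub>j\<rangle>)\<close>, so \<open>\<parallel>A\<parallel>\<^sup>2\<close>, the supremum of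
  \<open>\<parallel>x\<^sub>1 + \<dots> + x\<^sub>n\<parallel>\<^sup>2 / (\<Sum>i. \<parallel>x\<^sub>i\<parallel>\<^sup>2)\<close>, is the right-hand side (\<open>dixmier_term_eq\<close>).

  The direct sum itself never appears. The two inequalities contained in \<open>\<parallel>A A\<^sup>*\<parallel> = \<parallel>A\<parallel>\<^sup>2\<close> are proved
  in terms of families \<open>x\<close> as \<open>norm_sum_le_onorm_sum_proj\<close> and \<open>norm_sum_proj_le\<close>; both rest on the
  identity \<open>\<langle>A\<^sup>* v, A\<^sup>* v\<rangle> = \<langle>A A\<^sup>* v, v\<rangle>\<close>, which is \<open>sum_norm_proj_sq\<close>. That the projections exist at
  all is the projection theorem, \<open>ex_orth_proj\<close>.
\<close>

section \<open>The real part of a complex inner product\<close>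

abbreviation rinner :: "'a::complex_inner \<Rightarrow> 'a \<Rightarrow> real" where
  "rinner x y \<equiv> Re (cinner x y)"

lemma cinner_add_right: "cinner x (y + z) = cinner x y + cinner x z"
  for x y z :: "'a::complex_inner"
  by (metis cinner_commute cinner_add_left complex_cnj_add)

lemma cinner_zero_left: "cinner 0 y = 0"
  for y :: "'a::complex_inner"
  using cinner_add_left[of 0 0 y] by simp

lemma cinner_scaleC_right: "cinner x (scaleC a y) = cnj a * cinner x y"
  for x y :: "'a::complex_inner"
  by (metis cinner_commute cinner_scaleC_left complex_cnj_mult)

lemma cinner_scaleR_left: "cinner (r *\<^sub>R x) y = complex_of_real r * cinner x y"
  for x y :: "'a::complex_inner"
  by (simp add: scaleR_eq_scaleC cinner_scaleC_left)

lemma cinner_minus_left: "cinner (- x) y = - cinner x y"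
  for x y :: "'a::complex_inner"
  using cinner_scaleR_left[of "-1" x y] by simp

lemma cinner_diff_left: "cinner (x - y) z = cinner x z - cinner y z"
  for x y z :: "'a::complex_inner"
  using cinner_add_left[of x "- y" z] by (simp add: cinner_minus_left)

lemma rinner_commute: "rinner x y = rinner y x"
  by (metis cinner_commute complex_cnj(1) complex.sel(1) complex.exhaust_sel)

lemma rinner_sum_left: "rinner (\<Sum>i\<in>I. f i) y = (\<Sum>i\<in>I. rinner (f i) y)"
  for y :: "'a::complex_inner"
  by (induction I rule: infinite_finite_induct) (simp_all add: cinner_zero_left cinner_add_left)

lemma norm_sq_eq_rinner: "(norm x)\<^sup>2 = rinner x x"
  by (simp add: norm_eq_sqrt_cinner cinner_self_nonneg)

lemma norm_add_sq: "(norm (x + y))\<^sup>2 = (norm x)\<^sup>2 + 2 * rinner x y + (norm y)\<^sup>2"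
  for x y :: "'a::complex_inner"
  by (simp add: norm_sq_eq_rinner cinner_add_left cinner_add_right rinner_commute[of y x])

lemma norm_diff_sq: "(norm (x - y))\<^sup>2 = (norm x)\<^sup>2 - 2 * rinner x y + (norm y)\<^sup>2"
  for x y :: "'a::complex_inner"
  using norm_add_sq[of x "- y"] rinner_commute[of x "- y"] rinner_commute[of x y]
  by (simp add: cinner_minus_left)

text \<open>The triangle inequality is part of the class axioms, so Cauchy--Schwarz can be read off from it
  by squaring, the reverse of the usual order.\<close>

lemma rinner_le_norm_mult: "rinner x y \<le> norm x * norm y"
  for x y :: "'a::complex_inner"
proof -
  have "(norm (x + y))\<^sup>2 \<le> (norm x + norm y)\<^sup>2"
    by (simp add: norm_triangle_ineq power_mono)
  then show ?thesis
    by (simp add: norm_add_sq power2_sum)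
qed

lemma parallelogram: "(norm (x + y))\<^sup>2 + (norm (x - y))\<^sup>2 = 2 * (norm x)\<^sup>2 + 2 * (norm y)\<^sup>2"
  for x y :: "'a::complex_inner"
  by (simp add: norm_add_sq norm_diff_sq)

lemma norm_sum_sq:
  fixes x :: "nat \<Rightarrow> 'a::complex_inner"
  shows "(norm (\<Sum>i=1..n. x i))\<^sup>2 =
    (\<Sum>i=1..n. (norm (x i))\<^sup>2) + 2 * (\<Sum>j=1..n. \<Sum>i=1..<j. rinner (x i) (x j))"
proof (induction n)
  case (Suc n)
  have "rinner (\<Sum>i=1..n. x i) (x (Suc n)) = (\<Sum>i=1..<Suc n. rinner (x i) (x (Suc n)))"
    by (simp add: rinner_sum_left atLeastLessThanSuc_atLeastAtMost)
  with Suc show ?case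
    by (simp add: norm_add_sq)
qed simp

section \<open>Orthogonal projections\<close>

lemma subspace_add: "closed_complex_subspace M \<Longrightarrow> x \<in> M \<Longrightarrow> y \<in> M \<Longrightarrow> x + y \<in> M"
  by (simp add: closed_complex_subspace_def)

lemma subspace_scaleC: "closed_complex_subspace M \<Longrightarrow> x \<in> M \<Longrightarrow> scaleC a x \<in> M"
  by (simp add: closed_complex_subspace_def)

lemma subspace_scaleR: "closed_complex_subspace M \<Longrightarrow> x \<in> M \<Longrightarrow> r *\<^sub>R x \<in> M"
  by (simp add: scaleR_eq_scaleC subspace_scaleC)

lemma subspace_diff: "closed_complex_subspace M \<Longrightarrow> x \<in> M \<Longrightarrow> y \<in> M \<Longrightarrow> x - y \<in> M"
  using subspace_add[of M x "- y"] subspace_scaleR[of M y "-1"] by simp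

text \<open>A minimizing sequence for the distance to \<open>M\<close> is Cauchy: midpoints stay in \<open>M\<close>, so by the
  parallelogram law two points of \<open>M\<close> that are both almost closest to \<open>x\<close> are close to each other.
  Its limit lies in the closed set \<open>M\<close> and attains the distance.\<close>

lemma ex_closest_point:
  fixes M :: "'a::complex_hilbert_space set"
  assumes M: "closed_complex_subspace M"
  shows "\<exists>y\<in>M. \<forall>z\<in>M. norm (x - y) \<le> norm (x - z)"
proof -
  have "M \<noteq> {}"
    using M by (auto simp: closed_complex_subspace_def)
  define d where "d = (INF z\<in>M. norm (x - z))"
  have d_le: "d \<le> norm (x - z)" if "z \<in> M" for z
    unfolding d_def using that by (intro cINF_lower bdd_belowI[of _ 0]) auto
  have "d \<ge> 0"
    unfolding d_def using \<open>M \<noteq> {}\<close> by (intro cINF_greatest) auto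
  have "\<exists>z\<in>M. (norm (x - z))\<^sup>2 < d\<^sup>2 + 1 / real (Suc k)" for k
  proof -
    have "sqrt (d\<^sup>2 + 1 / real (Suc k)) > d"
      using \<open>d \<ge> 0\<close> by (intro real_less_rsqrt) simp
    then obtain z where "z \<in> M" "norm (x - z) < sqrt (d\<^sup>2 + 1 / real (Suc k))"
      unfolding d_def using \<open>M \<noteq> {}\<close> by (subst (asm) cINF_less_iff) (auto intro: bdd_belowI[of _ 0])
    then show ?thesis
      by (metis real_sqrt_less_iff real_sqrt_unique norm_ge_zero)
  qed
  then obtain y where y: "\<And>k. y k \<in> M"
    and y_less: "\<And>k. (norm (x - y k))\<^sup>2 < d\<^sup>2 + 1 / real (Suc k)"
    by metis
  have y_close: "(norm (y j - y k))\<^sup>2 < 2 / real (Suc j) + 2 / real (Suc k)" for j k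
  proof -
    have "(1/2) *\<^sub>R (y j + y k) \<in> M"
      by (intro subspace_scaleR subspace_add M y)
    then have "d \<le> norm (x - (1/2) *\<^sub>R (y j + y k))"
      by (rule d_le)
    also have "\<dots> = norm ((1/2) *\<^sub>R ((x - y j) + (x - y k)))"
      by (rule arg_cong[where f = norm])
        (simp add: algebra_simps flip: scaleR_add_left)
    also have "\<dots> = norm ((x - y j) + (x - y k)) / 2"
      by simp
    finally have "(2 * d)\<^sup>2 \<le> (norm ((x - y j) + (x - y k)))\<^sup>2"
      using \<open>d \<ge> 0\<close> by (intro power_mono) auto
    moreover have "(norm ((x - y j) - (x - y k)))\<^sup>2 = (norm (y j - y k))\<^sup>2"
      by (simp add: norm_minus_commute)
    ultimately show ?thesis
      using parallelogram[of "x - y j" "x - y k"] y_less[of j] y_less[of k]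
      by (simp add: power2_eq_square)
  qed
  have "Cauchy y"
  proof (rule metric_CauchyI)
    fix e :: real
    assume "e > 0"
    then obtain N where N: "inverse (real (Suc N)) < e\<^sup>2 / 4"
      using reals_Archimedean[of "e\<^sup>2 / 4"] by auto
    have "dist (y j) (y k) < e" if "j \<ge> N" "k \<ge> N" for j k
    proof (rule power2_less_imp_less)
      have "2 / real (Suc j) \<le> 2 / real (Suc N)" "2 / real (Suc k) \<le> 2 / real (Suc N)"
        using that by (auto intro!: divide_left_mono)
      then show "(dist (y j) (y k))\<^sup>2 < e\<^sup>2"
        using y_close[of j k] N by (simp add: dist_norm inverse_eq_divide)
    qed (use \<open>e > 0\<close> in simp)
    then show "\<exists>N. \<forall>j\<ge>N. \<forall>k\<ge>N. dist (y j) (y k) < e"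
      by blast
  qed
  then obtain l where l: "y \<longlonglongrightarrow> l"
    using Cauchy_convergent_iff convergent_def by blast
  have "closed M"
    using M by (simp add: closed_complex_subspace_def)
  then have "l \<in> M"
    using y l by (rule closed_sequentially)
  have "(\<lambda>k. (norm (x - y k))\<^sup>2) \<longlonglongrightarrow> (norm (x - l))\<^sup>2"
    by (intro tendsto_intros l)
  moreover have "(\<lambda>k. d\<^sup>2 + 1 / real (Suc k)) \<longlonglongrightarrow> d\<^sup>2 + 0"
    using LIMSEQ_inverse_real_of_nat by (intro tendsto_intros) (simp add: inverse_eq_divide)
  ultimately have "(norm (x - l))\<^sup>2 \<le> d\<^sup>2 + 0"
    by (rule LIMSEQ_le) (use y_less less_imp_le in blast)
  then have "norm (x - l) \<le> d"
    using \<open>d \<ge> 0\<close> power2_le_imp_le by auto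
  with \<open>l \<in> M\<close> d_le show ?thesis
    by (meson order_trans)
qed

text \<open>If \<open>y\<close> is closest to \<open>x\<close>, then moving \<open>y\<close> in the direction of \<open>z\<close> cannot decrease the distance,
  which forces the real part of \<open>\<langle>x - y, z\<rangle>\<close> to vanish; the direction \<open>\<i> z\<close> takes care of the imaginary
  part.\<close>

lemma ex_orth_proj:
  fixes M :: "'a::complex_hilbert_space set"
  assumes M: "closed_complex_subspace M"
  shows "\<exists>y\<in>M. \<forall>z\<in>M. cinner (x - y) z = 0"
proof -
  obtain y where y: "y \<in> M" and closest: "\<And>z. z \<in> M \<Longrightarrow> norm (x - y) \<le> norm (x - z)"
    using ex_closest_point[OF M] by blast
  have re: "rinner (x - y) z = 0" if "z \<in> M" for z
  proof (cases "z = 0")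
    case True
    then show ?thesis
      using rinner_commute[of "x - y" z] by (simp add: cinner_zero_left)
  next
    case False
    \<comment> \<open>the value of \<open>t\<close> that minimizes \<open>norm (x - y - t *\<^sub>R z)\<close>\<close>
    define t where "t = rinner (x - y) z / (norm z)\<^sup>2"
    have t: "t * (norm z)\<^sup>2 = rinner (x - y) z"
      using False by (simp add: t_def)
    have "norm (x - y) \<le> norm ((x - y) - t *\<^sub>R z)"
      using closest[OF subspace_add[OF M y subspace_scaleR[OF M that]]] by (simp add: diff_diff_eq)
    then have "(norm (x - y))\<^sup>2 \<le> (norm ((x - y) - t *\<^sub>R z))\<^sup>2"
      by (simp add: power_mono)
    also have "\<dots> = (norm (x - y))\<^sup>2 - 2 * (t * rinner (x - y) z) + t * (t * (norm z)\<^sup>2)"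
      using rinner_commute[of "x - y" "t *\<^sub>R z"] rinner_commute[of "x - y" z]
      by (simp add: norm_diff_sq cinner_scaleR_left power_mult_distrib power2_eq_square[of t])
    finally have "t * rinner (x - y) z \<le> 0"
      by (simp add: t)
    then have "t * t * (norm z)\<^sup>2 \<le> 0"
      by (simp add: mult.assoc t)
    then have "t = 0"
      using False by (auto simp: mult_le_0_iff)
    then show ?thesis
      using t by simp
  qed
  have "cinner (x - y) z = 0" if "z \<in> M" for z
    using re[OF that] re[OF subspace_scaleC[OF M that, of \<i>]]
    by (simp add: complex_eq_iff cinner_scaleC_right)
  with y show ?thesis
    by blast
qed

lemma orth_proj_unique:
  fixes M :: "'a::complex_inner set"
  assumes M: "closed_complex_subspace M"
    and "y \<in> M" "\<And>z. z \<in> M \<Longrightarrow> cinner (x - y) z = 0"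
    and "y' \<in> M" "\<And>z. z \<in> M \<Longrightarrow> cinner (x - y') z = 0"
  shows "y = y'"
proof -
  have "y - y' \<in> M"
    using assms by (simp add: subspace_diff)
  then have "cinner (x - y') (y - y') - cinner (x - y) (y - y') = 0"
    using assms by simp
  then have "cinner (y - y') (y - y') = 0"
    by (simp add: cinner_diff_left)
  then show ?thesis
    by (simp add: cinner_self_eq_0_iff)
qed

lemma orth_proj_eqI:
  fixes M :: "'a::complex_inner set"
  assumes "closed_complex_subspace M" "y \<in> M" "\<And>z. z \<in> M \<Longrightarrow> cinner (x - y) z = 0"
  shows "orth_proj M x = y"
  unfolding orth_proj_def
  using assms by (intro the_equality) (auto intro: orth_proj_unique)

context
  fixes M :: "'a::complex_hilbert_space set"
  assumes M: "closed_complex_subspace M"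
begin

lemma orth_proj_in: "orth_proj M x \<in> M"
  and orth_proj_orth: "z \<in> M \<Longrightarrow> cinner (x - orth_proj M x) z = 0"
  using ex_orth_proj[OF M, of x] orth_proj_eqI[OF M] by auto

lemma rinner_orth_proj: "z \<in> M \<Longrightarrow> rinner z (orth_proj M x) = rinner z x"
  using orth_proj_orth[of z x] rinner_commute[of z]
  by (simp add: cinner_diff_left)

lemma norm_orth_proj_sq: "(norm (orth_proj M x))\<^sup>2 = rinner (orth_proj M x) x"
  by (simp add: norm_sq_eq_rinner rinner_orth_proj orth_proj_in)

lemma norm_orth_proj_le: "norm (orth_proj M x) \<le> norm x"
proof -
  have "norm (orth_proj M x) * norm (orth_proj M x) \<le> norm (orth_proj M x) * norm x"
    using norm_orth_proj_sq[of x] rinner_le_norm_mult[of "orth_proj M x" x]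
    by (simp add: power2_eq_square)
  then show ?thesis
    by (cases "orth_proj M x = 0") auto
qed

lemma bounded_linear_orth_proj: "bounded_linear (orth_proj M)"
proof (rule bounded_linear_intro[where K = 1])
  show "orth_proj M (x + y) = orth_proj M x + orth_proj M y" for x y
  proof (rule orth_proj_eqI[OF M])
    show "cinner (x + y - (orth_proj M x + orth_proj M y)) z = 0" if "z \<in> M" for z
      using orth_proj_orth[OF that, of x] orth_proj_orth[OF that, of y]
      by (simp add: cinner_diff_left cinner_add_left)
  qed (simp add: subspace_add[OF M] orth_proj_in)
  show "orth_proj M (r *\<^sub>R x) = r *\<^sub>R orth_proj M x" for r x
  proof (rule orth_proj_eqI[OF M])
    show "cinner (r *\<^sub>R x - r *\<^sub>R orth_proj M x) z = 0" if "z \<in> M" for z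
      using orth_proj_orth[OF that, of x]
      by (simp add: cinner_scaleR_left flip: scaleR_diff_right)
  qed (simp add: subspace_scaleR[OF M] orth_proj_in)
qed (simp add: norm_orth_proj_le)

end

section \<open>Sums of projections\<close>

lemma sum_norm_proj_sq:
  fixes H :: "'i \<Rightarrow> 'a::complex_hilbert_space set"
  assumes "\<And>i. i \<in> I \<Longrightarrow> closed_complex_subspace (H i)"
  shows "(\<Sum>i\<in>I. (norm (orth_proj (H i) v))\<^sup>2) = rinner (\<Sum>i\<in>I. orth_proj (H i) v) v"
  by (simp add: rinner_sum_left norm_orth_proj_sq assms)

text \<open>This is \<open>\<parallel>A x\<parallel>\<^sup>2 \<le> \<parallel>A A\<^sup>*\<parallel> \<parallel>x\<parallel>\<^sup>2\<close>. With \<open>s = A x\<close> it follows from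
  \<open>\<parallel>s\<parallel>\<^sup>2 = Re \<langle>x, A\<^sup>* s\<rangle> \<le> \<parallel>x\<parallel> \<parallel>A\<^sup>* s\<parallel>\<close> and \<open>\<parallel>A\<^sup>* s\<parallel>\<^sup>2 = \<langle>A A\<^sup>* s, s\<rangle> \<le> \<parallel>A A\<^sup>*\<parallel> \<parallel>s\<parallel>\<^sup>2\<close>.\<close>

lemma norm_sum_le_onorm_sum_proj:
  fixes H :: "'i \<Rightarrow> 'a::complex_hilbert_space set"
  assumes H: "\<And>i. i \<in> I \<Longrightarrow> closed_complex_subspace (H i)"
    and x: "\<And>i. i \<in> I \<Longrightarrow> x i \<in> H i"
  shows "(norm (\<Sum>i\<in>I. x i))\<^sup>2 \<le>
    onorm (\<lambda>v. \<Sum>i\<in>I. orth_proj (H i) v) * (\<Sum>i\<in>I. (norm (x i))\<^sup>2)"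
proof -
  define S where "S = (\<lambda>v. \<Sum>i\<in>I. orth_proj (H i) v)"
  define s where "s = (\<Sum>i\<in>I. x i)"
  define X where "X = (\<Sum>i\<in>I. (norm (x i))\<^sup>2)"
  have S: "bounded_linear S"
    unfolding S_def by (intro bounded_linear_sum bounded_linear_orth_proj H)
  have "X \<ge> 0"
    by (simp add: X_def sum_nonneg)
  have "(\<Sum>i\<in>I. (norm (orth_proj (H i) s))\<^sup>2) = rinner (S s) s"
    unfolding S_def by (rule sum_norm_proj_sq[OF H])
  also have "\<dots> \<le> norm (S s) * norm s"
    by (rule rinner_le_norm_mult)
  also have "\<dots> \<le> onorm S * norm s * norm s"
    by (intro mult_right_mono onorm[OF S]) simp
  finally have proj_le: "(\<Sum>i\<in>I. (norm (orth_proj (H i) s))\<^sup>2) \<le> onorm S * (norm s)\<^sup>2"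
    by (simp add: power2_eq_square mult.assoc)
  have "(norm s)\<^sup>2 = (\<Sum>i\<in>I. rinner (x i) s)"
    by (simp add: norm_sq_eq_rinner) (simp add: s_def rinner_sum_left)
  also have "\<dots> = (\<Sum>i\<in>I. rinner (x i) (orth_proj (H i) s))"
    by (simp add: rinner_orth_proj H x)
  also have "\<dots> \<le> (\<Sum>i\<in>I. norm (x i) * norm (orth_proj (H i) s))"
    by (intro sum_mono rinner_le_norm_mult)
  finally have "((norm s)\<^sup>2)\<^sup>2 \<le> (\<Sum>i\<in>I. norm (x i) * norm (orth_proj (H i) s))\<^sup>2"
    by (intro power_mono) auto
  also have "\<dots> \<le> X * (\<Sum>i\<in>I. (norm (orth_proj (H i) s))\<^sup>2)"
    unfolding X_def by (rule Cauchy_Schwarz_ineq_sum)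
  also have "\<dots> \<le> X * (onorm S * (norm s)\<^sup>2)"
    using proj_le \<open>X \<ge> 0\<close> by (rule mult_left_mono)
  finally have *: "(norm s)\<^sup>2 * (norm s)\<^sup>2 \<le> onorm S * X * (norm s)\<^sup>2"
    by (simp add: power2_eq_square algebra_simps)
  have "(norm s)\<^sup>2 \<le> onorm S * X"
  proof (cases "s = 0")
    case True
    then show ?thesis
      using onorm_pos_le[OF S] \<open>X \<ge> 0\<close> by simp
  next
    case False
    then have "(norm s)\<^sup>2 > 0"
      by simp
    with * show ?thesis
      by (rule mult_right_le_imp_le)
  qed
  then show ?thesis
    by (simp add: S_def s_def X_def)
qed

text \<open>This is \<open>\<parallel>A A\<^sup>*\<parallel> \<le> K\<close> for every upper bound \<open>K\<close> of \<open>\<parallel>A\<parallel>\<^sup>2\<close>: the bound is applied to \<open>x = A\<^sup>* v\<close>,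
  and then \<open>\<parallel>A\<^sup>* v\<parallel>\<^sup>2 = \<langle>A A\<^sup>* v, v\<rangle> \<le> \<parallel>A A\<^sup>* v\<parallel> \<parallel>v\<parallel>\<close> allows one factor \<open>\<parallel>A A\<^sup>* v\<parallel>\<close> to be cancelled.\<close>

lemma norm_sum_proj_le:
  fixes H :: "'i \<Rightarrow> 'a::complex_hilbert_space set"
  assumes H: "\<And>i. i \<in> I \<Longrightarrow> closed_complex_subspace (H i)"
    and K: "\<And>x. (\<And>i. i \<in> I \<Longrightarrow> x i \<in> H i) \<Longrightarrow>
      (norm (\<Sum>i\<in>I. x i))\<^sup>2 \<le> K * (\<Sum>i\<in>I. (norm (x i))\<^sup>2)"
    and "K \<ge> 0"
  shows "norm (\<Sum>i\<in>I. orth_proj (H i) v) \<le> K * norm v"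
proof -
  let ?s = "\<Sum>i\<in>I. orth_proj (H i) v"
  have "(norm ?s)\<^sup>2 \<le> K * (\<Sum>i\<in>I. (norm (orth_proj (H i) v))\<^sup>2)"
    by (rule K) (simp add: orth_proj_in H)
  also have "\<dots> = K * rinner ?s v"
    by (simp add: sum_norm_proj_sq[OF H])
  also have "\<dots> \<le> K * (norm ?s * norm v)"
    using \<open>K \<ge> 0\<close> by (intro mult_left_mono rinner_le_norm_mult)
  finally have "norm ?s * norm ?s \<le> norm ?s * (K * norm v)"
    by (simp add: power2_eq_square algebra_simps)
  then show ?thesis
    using \<open>K \<ge> 0\<close> by (cases "?s = 0") (auto simp: mult_le_cancel_left)
qed

section \<open>The Dixmier number\<close>

lemma dixmier_term_eq:
  fixes x :: "nat \<Rightarrow> 'a::complex_inner"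
  assumes "n \<ge> 2" and "\<exists>i\<in>{1..n}. x i \<noteq> 0"
  shows "2 / (real n - 1) *
      ((\<Sum>j=1..n. \<Sum>i=1..<j. rinner (x i) (x j)) / (\<Sum>i=1..n. (norm (x i))\<^sup>2)) =
    ((norm (\<Sum>i=1..n. x i))\<^sup>2 / (\<Sum>i=1..n. (norm (x i))\<^sup>2) - 1) / (real n - 1)"
proof -
  have "(\<Sum>i=1..n. (norm (x i))\<^sup>2) \<noteq> 0"
    using assms(2) by (subst sum_nonneg_eq_0_iff) auto
  then show ?thesis
    using \<open>n \<ge> 2\<close> norm_sum_sq[where x = x and n = n] by (simp add: field_simps)
qed

theorem proposition1p1:
  fixes H :: "nat \<Rightarrow> 'a::complex_hilbert_space set"
    and P :: "nat \<Rightarrow> 'a \<Rightarrow> 'a"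
    and n :: nat
  assumes "n \<ge> 2"
    and "\<And>i. i \<in> {1..n} \<Longrightarrow> closed_complex_subspace (H i)"
    and "\<And>i. i \<in> {1..n} \<Longrightarrow> P i = orth_proj (H i)"
    and nonzero: "\<exists>i\<in>{1..n}. H i \<noteq> {0}"
  shows "onorm (\<lambda>v. \<Sum>i=1..n. P i v) = 1 + (real n - 1) * dixmier_number n H"
proof -
  note H = assms(2)
  have n: "real n - 1 > 0"
    using \<open>n \<ge> 2\<close> by simp
  define N where "N = onorm (\<lambda>v. \<Sum>i=1..n. orth_proj (H i) v)"
  have N: "onorm (\<lambda>v. \<Sum>i=1..n. P i v) = N"
    unfolding N_def using assms(3) by (intro arg_cong[where f = onorm] ext sum.cong) auto
  define F where "F = {x. (\<forall>i\<in>{1..n}. x i \<in> H i) \<and> (\<exists>i\<in>{1..n}. x i \<noteq> 0)}"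
  define X where "X x = (\<Sum>i=1..n. (norm (x i))\<^sup>2)" for x :: "nat \<Rightarrow> 'a"
  define q where "q x = (norm (\<Sum>i=1..n. x i))\<^sup>2 / X x" for x :: "nat \<Rightarrow> 'a"
  define c where "c = dixmier_number n H"
  have X_pos: "X x > 0" if "x \<in> F" for x
    using that unfolding X_def F_def by (auto intro: sum_pos2)
  have "{2 / (real n - 1) *
      ((\<Sum>j=1..n. \<Sum>i=1..<j. rinner (x i) (x j)) / (\<Sum>i=1..n. (norm (x i))\<^sup>2)) | x.
      (\<forall>i\<in>{1..n}. x i \<in> H i) \<and> (\<exists>i\<in>{1..n}. x i \<noteq> 0)} = (\<lambda>x. (q x - 1) / (real n - 1)) ` F"
    unfolding setcompr_eq_image F_def[symmetric]
    unfolding q_def X_def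
    by (intro image_cong refl dixmier_term_eq[OF \<open>n \<ge> 2\<close>]) (simp add: F_def)
  then have c: "c = (SUP x\<in>F. (q x - 1) / (real n - 1))"
    by (simp add: c_def dixmier_number_def)
  have q_le_N: "q x \<le> N" if "x \<in> F" for x
    using norm_sum_le_onorm_sum_proj[of "{1..n}" H x, OF H] X_pos[OF that] that
    by (simp add: q_def X_def N_def F_def divide_le_eq)
  have bdd: "bdd_above ((\<lambda>x. (q x - 1) / (real n - 1)) ` F)"
    using n q_le_N by (intro bdd_aboveI2[where M = "(N - 1) / (real n - 1)"] divide_right_mono) auto
  have "F \<noteq> {}"
  proof -
    obtain i h where i: "i \<in> {1..n}" "h \<in> H i" "h \<noteq> 0"
      using nonzero H by (force simp: closed_complex_subspace_def)
    have "(\<lambda>j. if j = i then h else 0) \<in> F"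
      using i H by (auto simp: F_def closed_complex_subspace_def)
    then show ?thesis
      by blast
  qed
  define K where "K = 1 + (real n - 1) * c"
  have q_le_K: "q x \<le> K" if "x \<in> F" for x
  proof -
    have "(q x - 1) / (real n - 1) \<le> c"
      unfolding c using that bdd by (rule cSUP_upper)
    then show ?thesis
      using n by (simp add: K_def field_simps)
  qed
  have "K \<ge> 0"
  proof -
    obtain x where "x \<in> F"
      using \<open>F \<noteq> {}\<close> by blast
    then have "0 \<le> q x"
      using X_pos by (simp add: q_def less_imp_le)
    then show ?thesis
      using q_le_K[OF \<open>x \<in> F\<close>] by simp
  qed
  have "N \<le> K"
    unfolding N_def
  proof (rule onorm_bound[OF \<open>K \<ge> 0\<close>], rule norm_sum_proj_le[of "{1..n}" H, OF H _ \<open>K \<ge> 0\<close>])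
    show "(norm (\<Sum>i=1..n. x i))\<^sup>2 \<le> K * (\<Sum>i=1..n. (norm (x i))\<^sup>2)"
      if "\<And>i. i \<in> {1..n} \<Longrightarrow> x i \<in> H i" for x
    proof (cases "x \<in> F")
      case True
      then show ?thesis
        using q_le_K X_pos by (simp add: q_def X_def divide_le_eq)
    next
      case False
      with that have "\<forall>i\<in>{1..n}. x i = 0"
        by (auto simp: F_def)
      then show ?thesis
        by simp
    qed
  qed auto
  moreover have "K \<le> N"
  proof -
    have "c \<le> (N - 1) / (real n - 1)"
      unfolding c using \<open>F \<noteq> {}\<close> n q_le_N by (intro cSUP_least divide_right_mono) auto
    then show ?thesis
      using n by (simp add: K_def field_simps)
  qed
  ultimately have "N = K"
    by simp
  then show ?thesis
    unfolding N K_def c_def .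
qed

end
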